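(* Let $G$ be a $T_1$ topological locally compact fan loop for which there exists a compact subgroup $N_0=N_0(G)$ in $N(G)$ such that $t(a,b,c)\in N_0$ and $p(a,b,c)\in N_0$ for all $a,b,c\in G$. Let $J$ and $H$ be functionals on $C^+_{0,0}(G)$, each of which (written $F$ here) satisfies: (1) $F(f)\ge 0$ for each $f\in C^+_{0,0}(G)$, and if $f$ is nonzero, then $F(f)>0$; (2) $F(\alpha_1f_1+\dots+\alpha_nf_n)=\alpha_1F(f_1)+\dots+\alpha_nF(f_n)$ for all $f_1,\dots,f_n\in C^+_{0,0}(G)$ and $\alpha_1\ge 0,\dots,\alpha_n\ge 0$; (3) $F({}_bf)=F(f)$ for each $b\in G$ and $f\in C^+_{0,0}(G)$, where ${}_bf(x)=f(bx)$. Then there exists a positive constant $\kappa$ such that $H(f)=\kappa J(f)$ for each $f\in C^+_{0,0}(G)$.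
   Context: A loop is a set $G$ with a binary multiplication such that for all $a,b\in G$ there is a unique $x$ with $ax=b$ (written $x=a\backslash b$) and a unique $y$ with $ya=b$ (written $y=b/a$), and there is $e\in G$ with $eg=ge=g$ for all $g$. The nucleus is $N(G)=\{a\in G:\ (ab)c=a(bc),\ (ba)c=b(ac),\ (bc)a=b(ca)\ \text{for all } b,c\in G\}$; it is a group. A fan loop is a loop such that for all $a,b,c\in G$ there are $t(a,b,c),p(a,b,c)\in N(G)$ with $(ab)c=t(a,b,c)\,(a(bc))$ and $(ab)c=(a(bc))\,p(a,b,c)$ (these elements are then unique). A topological fan loop is a fan loop with a topology for which multiplication, $(a,b)\mapsto a\backslash b$ and $(a,b)\mapsto b/a$ are jointly continuous. The fan $N_0(G)$ is the minimal closed subgroup of $G$ containing all $t(a,b,c)$ and $p(a,b,c)$. $C_{0,0}^+(G)$ is the set of continuous functions $f:G\to[0,\infty)$ with compact support. Functionals are real-valued. *)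

theory Defs
  imports "HOL-Analysis.Analysis" "HOL-Algebra.Group"
begin

locale loop =
  fixes mul :: "'a \<Rightarrow> 'a \<Rightarrow> 'a"  (infixl \<open>\<cdot>\<close> 70)
  assumes ex1_left_quotient: "\<exists>!x. a \<cdot> x = b"
    and ex1_right_quotient: "\<exists>!y. y \<cdot> a = b"
    and ex_unit: "\<exists>e. \<forall>g. e \<cdot> g = g \<and> g \<cdot> e = g"
begin

definition unit :: 'a  (\<open>\<e>\<close>)
  where "\<e> = (THE e. \<forall>g. e \<cdot> g = g \<and> g \<cdot> e = g)"

definition ldiv :: "'a \<Rightarrow> 'a \<Rightarrow> 'a"
  where "ldiv a b = (THE x. a \<cdot> x = b)"

definition rdiv :: "'a \<Rightarrow> 'a \<Rightarrow> 'a"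
  where "rdiv b a = (THE y. y \<cdot> a = b)"

definition nucleus :: "'a set"
  where "nucleus =
    {a. \<forall>b c. (a \<cdot> b) \<cdot> c = a \<cdot> (b \<cdot> c) \<and> (b \<cdot> a) \<cdot> c = b \<cdot> (a \<cdot> c)
              \<and> (b \<cdot> c) \<cdot> a = b \<cdot> (c \<cdot> a)}"

text \<open>
  A subgroup of a loop is a subset that is a group under the restricted multiplication. Taking
  the unit of the loop as its unit is no restriction: an idempotent of a loop is the unit.
\<close>
definition is_subgroup :: "'a set \<Rightarrow> bool"
  where "is_subgroup S \<longleftrightarrow> group \<lparr>carrier = S, monoid.mult = (\<cdot>), one = \<e>\<rparr>"

definition t :: "'a \<Rightarrow> 'a \<Rightarrow> 'a \<Rightarrow> 'a"
  where "t a b c = (THE s. s \<in> nucleus \<and> (a \<cdot> b) \<cdot> c = s \<cdot> (a \<cdot> (b \<cdot> c)))"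

definition p :: "'a \<Rightarrow> 'a \<Rightarrow> 'a \<Rightarrow> 'a"
  where "p a b c = (THE s. s \<in> nucleus \<and> (a \<cdot> b) \<cdot> c = (a \<cdot> (b \<cdot> c)) \<cdot> s)"

end

locale fan_loop = loop +
  assumes ex_t: "\<exists>s \<in> nucleus. (a \<cdot> b) \<cdot> c = s \<cdot> (a \<cdot> (b \<cdot> c))"
    and ex_p: "\<exists>s \<in> nucleus. (a \<cdot> b) \<cdot> c = (a \<cdot> (b \<cdot> c)) \<cdot> s"

locale topological_fan_loop = fan_loop mul
  for mul :: "'a::topological_space \<Rightarrow> 'a \<Rightarrow> 'a"  (infixl \<open>\<cdot>\<close> 70) +
  assumes continuous_mul: "continuous_on UNIV (\<lambda>(a, b). a \<cdot> b)"
    and continuous_ldiv: "continuous_on UNIV (\<lambda>(a, b). ldiv a b)"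
    and continuous_rdiv: "continuous_on UNIV (\<lambda>(a, b). rdiv b a)"
begin

definition fan :: "'a set"
  where "fan = (\<lambda>S. closed S \<and> is_subgroup S) hull ({t a b c | a b c. True} \<union> {p a b c | a b c. True})"

end

definition C00_plus :: "('a::topological_space \<Rightarrow> real) set"
  where "C00_plus =
    {f. continuous_on UNIV f \<and> (\<forall>x. f x \<ge> 0) \<and> compact (closure (support_on UNIV f))}"

text \<open>
  Functionals on \<^const>\<open>C00_plus\<close> are total functions in HOL; only their values on
  \<^const>\<open>C00_plus\<close> are constrained.
\<close>
definition left_invariant_functional ::
    "('a \<Rightarrow> 'a \<Rightarrow> 'a) \<Rightarrow> (('a::topological_space \<Rightarrow> real) \<Rightarrow> real) \<Rightarrow> bool"
  where "left_invariant_functional mul F \<longleftrightarrow>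
    (\<forall>f \<in> C00_plus. F f \<ge> 0 \<and> (f \<noteq> (\<lambda>x. 0) \<longrightarrow> F f > 0)) \<and>
    (\<forall>(n::nat) \<ge> 1. \<forall>f \<alpha>. (\<forall>i \<in> {1..n}. f i \<in> C00_plus \<and> \<alpha> i \<ge> 0) \<longrightarrow>
       F (\<lambda>x. \<Sum>i = 1..n. \<alpha> i * f i x) = (\<Sum>i = 1..n. \<alpha> i * F (f i))) \<and>
    (\<forall>b. \<forall>f \<in> C00_plus. F (\<lambda>x. f (mul b x)) = F f)"

end

theory Submission
  imports Defs
begin

text \<open>
  The theorem is the uniqueness of Haar measure, transported to a loop that is a group up to its
  fan \<open>N\<^sub>0\<close>. Two facts make the transport possible.

  First, the fan is normal (theorem \<open>fan_normalizing\<close>). Comparing bracketings of a product of four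
  elements shows that every \<open>p a b c\<close>, and then every \<open>t a b c\<close>, can be moved across any element of
  the loop at the price of changing it within the fan. The elements of the fan with this property
  form a closed subgroup, so minimality of the fan gives the property to all of them. Consequently
  the quotient by the fan is a group, and a function that is invariant under the fan obeys the
  group laws in its argument. The quotient itself is never formed; all computations take place with
  fan-invariant functions on the loop.

  Second, every functional in question is determined by its values on fan-invariant functions. Fix
  an invariant bump \<open>\<beta>\<close>. The convolution \<open>A x = J (\<lambda>y. f (ldiv y x) * \<beta> y)\<close> is fan-invariant, and
  exchanging the two functionals gives \<open>H A = H f * J \<beta>\<close> for every left invariant \<open>H\<close>, with \<open>H = J\<close>
  among them. So the average over the fan is formed with \<open>J\<close> itself, and no invariant integral on
  the compact group \<open>N\<^sub>0\<close> has to be constructed.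

  For invariant functions Weil's proof applies: substitution and an exchange of functionals give
  \<open>H f * J g = J (\<lambda>z. f (ldiv z \<e>) * H (\<lambda>x. g (x \<cdot> z)))\<close> (lemma \<open>Weil_formula\<close>). The left-hand side
  depends on \<open>g\<close> only through the factor \<open>J g\<close>, so the densities \<open>\<lambda>z. H (\<lambda>x. g (x \<cdot> z))\<close> of different
  \<open>g\<close> are proportional to \<open>J g\<close>; at \<open>z = \<e>\<close> this says that \<open>H g / J g\<close> does not depend on \<open>g\<close>.

  The exchange of functionals is a Fubini theorem for positive linear functionals on continuous
  functions of compact support, proved with partitions of unity.
\<close>

section \<open>Compactly supported functions on a locally compact Hausdorff space\<close>

lemma continuous_on_compose_pair:
  assumes "continuous_on UNIV (\<lambda>(x, y). F x y)" "continuous_on S a" "continuous_on S b"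
  shows "continuous_on S (\<lambda>z. F (a z) (b z))"
  using continuous_on_compose2[OF assms(1) continuous_on_Pair[OF assms(2,3)]] by simp

lemma continuous_on_swap_arguments:
  assumes "continuous_on UNIV (\<lambda>(x, y). F x y)"
  shows "continuous_on UNIV (\<lambda>(y, x). F x y)"
  unfolding case_prod_unfold
  by (rule continuous_on_compose_pair[OF assms]) (intro continuous_intros)+

lemma compact_image_pair:
  assumes "continuous_on UNIV (\<lambda>(x, y). F x y)" "compact A" "compact B"
  shows "compact ((\<lambda>(x, y). F x y) ` (A \<times> B))"
  using assms by (intro compact_continuous_image compact_Times) (auto intro: continuous_on_subset)

text \<open>The tube lemma, applied to the open set where \<open>F x y\<close> differs from \<open>F x0 y\<close> by less than \<open>e\<close>.\<close>
lemma equicontinuous_over_compact: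
  fixes F :: "'a::topological_space \<Rightarrow> 'b::topological_space \<Rightarrow> real"
  assumes F: "continuous_on UNIV (\<lambda>(x, y). F x y)" and K: "compact K" and e: "0 < e"
  obtains W where "open W" "x0 \<in> W" "\<And>x y. x \<in> W \<Longrightarrow> y \<in> K \<Longrightarrow> \<bar>F x y - F x0 y\<bar> < e"
proof -
  define V where "V = {z. \<bar>F (fst z) (snd z) - F x0 (snd z)\<bar> < e}"
  have "continuous_on UNIV (\<lambda>z. F (fst z) (snd z))"
    by (rule continuous_on_compose_pair[OF F]) (intro continuous_intros)+
  moreover have "continuous_on UNIV (\<lambda>z. F x0 (snd z))"
    by (rule continuous_on_compose_pair[OF F]) (intro continuous_intros)+
  ultimately have V: "open V"
    unfolding V_def by (intro open_Collect_less continuous_intros)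
  have "{x0} \<times> K \<subseteq> V" using e by (auto simp: V_def)
  from Elementary_Topology.tube_lemma[OF K V this]
  obtain W where "x0 \<in> W" "open W" and sub: "W \<times> K \<subseteq> V" by blast
  then show ?thesis
  proof (intro that[of W])
    fix x y assume "x \<in> W" "y \<in> K"
    then have "(x, y) \<in> V" using sub by blast
    then show "\<bar>F x y - F x0 y\<bar> < e" by (simp add: V_def)
  qed
qed

lemma C00_plus_continuous: "f \<in> C00_plus \<Longrightarrow> continuous_on UNIV f"
  and C00_plus_nonneg: "f \<in> C00_plus \<Longrightarrow> 0 \<le> f x"
  by (auto simp: C00_plus_def)

lemma C00_plus_support:
  assumes "f \<in> C00_plus"
  obtains K where "compact K" "\<And>x. x \<notin> K \<Longrightarrow> f x = 0"
  using assms closure_subset[of "support_on UNIV f"]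
  by (auto simp: C00_plus_def support_on_def subset_iff)

lemma C00_plus_zero: "(\<lambda>x. 0) \<in> C00_plus"
  by (simp add: C00_plus_def support_on_def)

definition positive_functional :: "(('a::topological_space \<Rightarrow> real) \<Rightarrow> real) \<Rightarrow> bool"
  where "positive_functional F \<longleftrightarrow>
    (\<forall>f \<in> C00_plus. 0 \<le> F f) \<and>
    (\<forall>f \<in> C00_plus. \<forall>g \<in> C00_plus. F (\<lambda>x. f x + g x) = F f + F g) \<and>
    (\<forall>f \<in> C00_plus. \<forall>c \<ge> 0. F (\<lambda>x. c * f x) = c * F f)"

lemma positive_functional_nonneg:
    "positive_functional F \<Longrightarrow> f \<in> C00_plus \<Longrightarrow> 0 \<le> F f"
  and positive_functional_add:
    "positive_functional F \<Longrightarrow> f \<in> C00_plus \<Longrightarrow> g \<in> C00_plus \<Longrightarrow>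
      F (\<lambda>x. f x + g x) = F f + F g"
  and positive_functional_scale:
    "positive_functional F \<Longrightarrow> f \<in> C00_plus \<Longrightarrow> 0 \<le> c \<Longrightarrow> F (\<lambda>x. c * f x) = c * F f"
  by (auto simp: positive_functional_def)

context
  assumes hausdorff: "Hausdorff_space (euclidean :: 'a::topological_space topology)"
begin

lemma C00_plusI:
  fixes f :: "'a \<Rightarrow> real"
  assumes "continuous_on UNIV f" "\<And>x. 0 \<le> f x" "compact K" "\<And>x. x \<notin> K \<Longrightarrow> f x = 0"
  shows "f \<in> C00_plus"
proof -
  have "closed K"
    using compactin_imp_closedin[OF hausdorff] assms(3) by (metis compactin_euclidean_iff closed_closedin)
  then have "closure (support_on UNIV f) \<subseteq> K"
    using assms(4) by (intro closure_minimal) (auto simp: support_on_def)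
  then have "closure (support_on UNIV f) = K \<inter> closure (support_on UNIV f)" by blast
  then have "compact (closure (support_on UNIV f))"
    using compact_Int_closed[OF assms(3) closed_closure] by metis
  then show ?thesis using assms by (simp add: C00_plus_def)
qed

lemma C00_plus_mult:
  fixes f g :: "'a \<Rightarrow> real"
  assumes f: "f \<in> C00_plus" and g: "continuous_on UNIV g" "\<And>x. 0 \<le> g x"
  shows "(\<lambda>x. f x * g x) \<in> C00_plus"
proof -
  obtain K where "compact K" "\<And>x. x \<notin> K \<Longrightarrow> f x = 0" using C00_plus_support[OF f] by metis
  then show ?thesis
    by (intro C00_plusI[of _ K] continuous_intros C00_plus_continuous[OF f] g)
      (auto simp: C00_plus_nonneg[OF f] g)
qed

lemma C00_plus_scale:
  fixes f :: "'a \<Rightarrow> real"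
  shows "f \<in> C00_plus \<Longrightarrow> 0 \<le> c \<Longrightarrow> (\<lambda>x. c * f x) \<in> C00_plus"
  using C00_plus_mult[of f "\<lambda>_. c"] by (simp add: mult.commute)

lemma C00_plus_add:
  fixes f g :: "'a \<Rightarrow> real"
  assumes f: "f \<in> C00_plus" and g: "g \<in> C00_plus"
  shows "(\<lambda>x. f x + g x) \<in> C00_plus"
proof -
  obtain K where "compact K" "\<And>x. x \<notin> K \<Longrightarrow> f x = 0" using C00_plus_support[OF f] by metis
  moreover obtain L where "compact L" "\<And>x. x \<notin> L \<Longrightarrow> g x = 0" using C00_plus_support[OF g] by metis
  ultimately show ?thesis
    by (intro C00_plusI[of _ "K \<union> L"] continuous_intros C00_plus_continuous[OF f]
        C00_plus_continuous[OF g])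
      (auto simp: C00_plus_nonneg[OF f] C00_plus_nonneg[OF g])
qed

lemma C00_plus_sum:
  fixes f :: "'i \<Rightarrow> 'a \<Rightarrow> real"
  assumes "finite S" "\<And>s. s \<in> S \<Longrightarrow> f s \<in> C00_plus"
  shows "(\<lambda>x. \<Sum>s\<in>S. f s x) \<in> C00_plus"
  using assms by (induction S) (auto intro: C00_plus_zero C00_plus_add)

lemma C00_plus_positive_part:
  fixes f g :: "'a \<Rightarrow> real"
  assumes f: "f \<in> C00_plus" and g: "g \<in> C00_plus"
  shows "(\<lambda>x. max (f x - g x) 0) \<in> C00_plus"
proof -
  obtain K where "compact K" "\<And>x. x \<notin> K \<Longrightarrow> f x = 0" using C00_plus_support[OF f] by metis
  then show ?thesis
    by (intro C00_plusI[of _ K] continuous_intros C00_plus_continuous[OF f]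
        C00_plus_continuous[OF g])
      (auto simp: C00_plus_nonneg[OF g])
qed

lemma C00_plus_section:
  fixes F :: "'b::topological_space \<Rightarrow> 'a \<Rightarrow> real"
  assumes F: "continuous_on UNIV (\<lambda>(x, y). F x y)" "\<And>x y. 0 \<le> F x y"
    and K: "compact K" "\<And>x y. y \<notin> K \<Longrightarrow> F x y = 0"
  shows "F x \<in> C00_plus"
proof (rule C00_plusI[OF _ F(2) K])
  show "continuous_on UNIV (F x)"
    by (rule continuous_on_compose_pair[OF F(1)]) (intro continuous_intros)+
qed

context
  assumes locally_compact: "locally_compact_space (euclidean :: 'a topology)"
begin

lemma ex_bump:
  fixes s :: 'a
  assumes "open W" "s \<in> W"
  obtains b where "b \<in> C00_plus" "0 < b s" "\<And>x. x \<notin> W \<Longrightarrow> b x = 0"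
proof -
  have "completely_regular_space (euclidean :: 'a topology)"
    using locally_compact_regular_imp_completely_regular_space[OF locally_compact]
      locally_compact_Hausdorff_imp_regular_space[OF locally_compact hausdorff] hausdorff by blast
  moreover obtain U K where U: "open U" "s \<in> U" "U \<subseteq> K" and K: "compact K"
    using locally_compact unfolding locally_compact_space_def by (auto dest: spec[of _ s])
  moreover have "closedin euclidean (- (U \<inter> W))"
    using closed_Compl[OF open_Int[OF U(1) assms(1)]] by (simp only: closed_closedin)
  ultimately obtain f :: "'a \<Rightarrow> real" where
    f: "continuous_map euclidean (top_of_set {0..1}) f" "f s = 0" "f ` (- (U \<inter> W)) \<subseteq> {1}"
    using U(2) assms(2) unfolding completely_regular_space_def
    by (auto dest!: spec[of _ "- (U \<inter> W)"] spec[of _ s])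
  have cont: "continuous_on UNIV f" and ran: "f x \<in> {0..1}" for x
    using f(1) by (auto simp: continuous_map_in_subtopology)
  show ?thesis
  proof
    show "(\<lambda>x. 1 - f x) \<in> C00_plus"
      using ran f(3) U(3)
      by (intro C00_plusI[OF _ _ K] continuous_intros cont) (auto simp: image_subset_iff)
  qed (use f in \<open>auto simp: image_subset_iff\<close>)
qed

text \<open>Finitely many bumps cover the compact set, and their sum is at least some positive constant
  there; dividing by the sum truncated below at that constant keeps the quotient continuous on the
  whole space.\<close>
lemma partition_of_unity:
  fixes K :: "'a set"
  assumes K: "compact K" and W: "\<And>s. s \<in> K \<Longrightarrow> open (W s) \<and> s \<in> W s"
  obtains S h where "finite S" "S \<subseteq> K" "\<And>s. s \<in> S \<Longrightarrow> h s \<in> C00_plus"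
    "\<And>s x. s \<in> S \<Longrightarrow> x \<notin> W s \<Longrightarrow> h s x = 0"
    "\<And>x. x \<in> K \<Longrightarrow> (\<Sum>s\<in>S. h s x) = 1" "\<And>x. (\<Sum>s\<in>S. h s x) \<le> 1"
proof -
  have "\<exists>b. b \<in> C00_plus \<and> 0 < b s \<and> (\<forall>x. x \<notin> W s \<longrightarrow> b x = 0)" if "s \<in> K" for s
    using ex_bump[of "W s" s] W[OF that] by metis
  then obtain b where b: "\<And>s. s \<in> K \<Longrightarrow> b s \<in> C00_plus" "\<And>s. s \<in> K \<Longrightarrow> 0 < b s s"
    "\<And>s x. s \<in> K \<Longrightarrow> x \<notin> W s \<Longrightarrow> b s x = 0"
    by metis
  have "open {x. 0 < b s x}" if "s \<in> K" for s
    by (intro open_Collect_less continuous_intros C00_plus_continuous b that)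
  moreover have "K \<subseteq> (\<Union>s\<in>K. {x. 0 < b s x})" using b(2) by blast
  ultimately obtain S where S: "finite S" "S \<subseteq> K" "K \<subseteq> (\<Union>s\<in>S. {x. 0 < b s x})"
    using compactE_image[OF K] by metis
  define B where "B x = (\<Sum>s\<in>S. b s x)" for x
  have B: "B \<in> C00_plus"
    unfolding B_def using S b by (intro C00_plus_sum) auto
  have B_pos: "0 < B x" if x: "x \<in> K" for x
  proof -
    obtain s where "s \<in> S" "0 < b s x" using S x by blast
    then show ?thesis
      unfolding B_def using S b(1) C00_plus_nonneg by (intro sum_pos2[of _ s]) (simp, simp, simp, blast)
  qed
  obtain c where c: "0 < c" "\<And>x. x \<in> K \<Longrightarrow> c \<le> B x"
  proof (cases "K = {}")
    case False
    then obtain m where "m \<in> K" "\<And>x. x \<in> K \<Longrightarrow> B m \<le> B x"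
      using continuous_attains_inf[OF K False continuous_on_subset[OF C00_plus_continuous[OF B]]]
      by blast
    then show ?thesis using that[of "B m"] B_pos by auto
  qed (use that[of 1] in auto)
  define h where "h s x = b s x * inverse (max (B x) c)" for s x
  have sum_h: "(\<Sum>s\<in>S. h s x) = B x / max (B x) c" for x
    by (simp add: h_def B_def sum_distrib_right divide_inverse)
  show ?thesis
  proof
    fix s assume s: "s \<in> S"
    show "h s \<in> C00_plus"
      unfolding h_def using c(1) s S b(1)
      by (intro C00_plus_mult continuous_intros C00_plus_continuous[OF B]) (auto simp: max_def)
    show "h s x = 0" if "x \<notin> W s" for x
      using b(3) s S that by (auto simp: h_def)
  next
    show "(\<Sum>s\<in>S. h s x) = 1" if "x \<in> K" for x
      using c B_pos[OF that] that by (simp add: sum_h max_def antisym)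
    show "(\<Sum>s\<in>S. h s x) \<le> 1" for x
      using c(1) by (simp add: sum_h max_def)
  qed (use S in auto)
qed

corollary ex_cutoff:
  fixes K :: "'a set"
  assumes "compact K"
  obtains k where "k \<in> C00_plus" "\<And>x. x \<in> K \<Longrightarrow> k x = 1"
proof (rule partition_of_unity[OF assms, of "\<lambda>_. UNIV"])
  fix S :: "'a set" and h :: "'a \<Rightarrow> 'a \<Rightarrow> real"
  assume "finite S" "\<And>s. s \<in> S \<Longrightarrow> h s \<in> C00_plus"
    "\<And>x. x \<in> K \<Longrightarrow> (\<Sum>s\<in>S. h s x) = 1"
  then show thesis by (intro that[of "\<lambda>x. \<Sum>s\<in>S. h s x"] C00_plus_sum)
qed auto

section \<open>Iterated positive functionals\<close>

lemma positive_combination_in_C00_plus: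
  fixes f :: "'i \<Rightarrow> 'a \<Rightarrow> real"
  assumes "finite S" "\<And>s. s \<in> S \<Longrightarrow> f s \<in> C00_plus" "\<And>s. s \<in> S \<Longrightarrow> 0 \<le> c s"
  shows "(\<lambda>x. \<Sum>s\<in>S. c s * f s x) \<in> C00_plus"
  using assms by (intro C00_plus_sum C00_plus_scale)

lemma positive_functional_combination:
  fixes F :: "('a \<Rightarrow> real) \<Rightarrow> real"
  assumes F: "positive_functional F"
    and "finite S" "\<And>s. s \<in> S \<Longrightarrow> f s \<in> C00_plus" "\<And>s. s \<in> S \<Longrightarrow> 0 \<le> c s"
  shows "F (\<lambda>x. \<Sum>s\<in>S. c s * f s x) = (\<Sum>s\<in>S. c s * F (f s))"
  using assms(2-4)
proof (induction S)
  case empty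
  then show ?case using positive_functional_scale[OF F C00_plus_zero, of 0] by simp
next
  case (insert s S)
  then have "F (\<lambda>x. c s * f s x + (\<Sum>s\<in>S. c s * f s x)) =
      c s * F (f s) + F (\<lambda>x. \<Sum>s\<in>S. c s * f s x)"
    by (subst positive_functional_add[OF F])
      (auto intro!: C00_plus_scale positive_combination_in_C00_plus positive_functional_scale[OF F])
  with insert show ?case by simp
qed

lemma positive_functional_diff:
  fixes F :: "('a \<Rightarrow> real) \<Rightarrow> real"
  assumes F: "positive_functional F" and fg: "f \<in> C00_plus" "g \<in> C00_plus" and k: "k \<in> C00_plus"
    and le: "\<And>x. \<bar>f x - g x\<bar> \<le> e * k x" and e: "0 \<le> e"
  shows "\<bar>F f - F g\<bar> \<le> e * F k"
proof -
  have mono: "F f \<le> F g" if "f \<in> C00_plus" "g \<in> C00_plus" "\<And>x. f x \<le> g x" for f g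
  proof -
    have d: "(\<lambda>x. g x - f x) \<in> C00_plus"
      using C00_plus_positive_part[OF that(2,1)] that(3) by (simp add: max_absorb1)
    from positive_functional_add[OF F that(1) d] positive_functional_nonneg[OF F d]
    show ?thesis by simp
  qed
  have upper: "F f \<le> F g + e * F k"
    if "f \<in> C00_plus" "g \<in> C00_plus" "\<And>x. \<bar>f x - g x\<bar> \<le> e * k x" for f g
  proof -
    have ek: "(\<lambda>x. e * k x) \<in> C00_plus" using C00_plus_scale[OF k e] .
    have "F f \<le> F (\<lambda>x. g x + e * k x)"
    proof (rule mono[OF that(1) C00_plus_add[OF that(2) ek]])
      show "f x \<le> g x + e * k x" for x using that(3)[of x] by linarith
    qed
    also have "\<dots> = F g + e * F k"
      using positive_functional_add[OF F that(2) ek] positive_functional_scale[OF F k e] by simp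
    finally show ?thesis .
  qed
  show ?thesis
    using upper[OF fg le] upper[OF fg(2,1)] le by (simp add: abs_minus_commute abs_le_iff)
qed

text \<open>Nearby sections differ by at most a small multiple of one cutoff function, and \<open>J\<close> turns this
  into a bound on the difference of their values.\<close>
lemma functional_of_sections_in_C00_plus:
  fixes F :: "'a \<Rightarrow> 'a \<Rightarrow> real"
  assumes J: "positive_functional J" and K: "compact K"
    and F: "continuous_on UNIV (\<lambda>(x, y). F x y)" "\<And>x y. 0 \<le> F x y"
      "\<And>x y. x \<notin> K \<or> y \<notin> K \<Longrightarrow> F x y = 0"
  shows "(\<lambda>x. J (F x)) \<in> C00_plus"
proof -
  have sec: "F x \<in> C00_plus" for x
    by (rule C00_plus_section[OF F(1,2) K], simp add: F(3))
  obtain k where k: "k \<in> C00_plus" "\<And>x. x \<in> K \<Longrightarrow> k x = 1" by (rule ex_cutoff[OF K]) (rule that)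
  have Jk: "0 \<le> J k" using positive_functional_nonneg[OF J k(1)] .
  have "((\<lambda>x. J (F x)) \<longlongrightarrow> J (F x0)) (at x0)" for x0
  proof (rule tendstoI)
    fix e :: real assume e: "0 < e"
    define d where "d = e / (J k + 1)"
    have d: "0 < d" using e Jk by (simp add: d_def)
    obtain W where W: "open W" "x0 \<in> W" "\<And>x y. x \<in> W \<Longrightarrow> y \<in> K \<Longrightarrow> \<bar>F x y - F x0 y\<bar> < d"
      by (rule equicontinuous_over_compact[OF F(1) K d, of x0]) (rule that)
    have "\<bar>J (F x) - J (F x0)\<bar> < e" if x: "x \<in> W" for x
    proof -
      have "\<bar>J (F x) - J (F x0)\<bar> \<le> d * J k"
      proof (rule positive_functional_diff[OF J sec sec k(1)])
        show "\<bar>F x y - F x0 y\<bar> \<le> d * k y" for y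
        proof (cases "y \<in> K")
          case True
          then show ?thesis using W(3)[OF x True] k(2)[OF True] by simp
        next
          case False
          then show ?thesis using F(3) d C00_plus_nonneg[OF k(1)] by simp
        qed
      qed (use d in simp)
      also have "\<dots> < d * (J k + 1)" using d by simp
      also have "\<dots> = e" using Jk by (simp add: d_def)
      finally show ?thesis .
    qed
    then show "\<forall>\<^sub>F x in at x0. dist (J (F x)) (J (F x0)) < e"
      unfolding eventually_at_topological dist_real_def by (intro exI[of _ W]) (simp add: W(1,2))
  qed
  then have cont: "continuous_on UNIV (\<lambda>x. J (F x))" unfolding continuous_on_def by blast
  have zero: "J (F x) = 0" if "x \<notin> K" for x
  proof -
    have "F x = (\<lambda>y. 0)" by (rule ext) (simp add: F(3) that)
    then show ?thesis using positive_functional_scale[OF J C00_plus_zero, of 0] by simp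
  qed
  show ?thesis
    by (rule C00_plusI[OF cont positive_functional_nonneg[OF J sec] K zero])
qed

text \<open>The points of \<open>K\<close> have neighbourhoods on which \<open>F\<close> varies by less than \<open>e\<close> in its second
  argument; a partition of unity subordinate to finitely many of them interpolates \<open>F\<close>.\<close>
lemma uniform_product_approximation:
  fixes F :: "'a \<Rightarrow> 'a \<Rightarrow> real"
  assumes K: "compact K"
    and F: "continuous_on UNIV (\<lambda>(x, y). F x y)" "\<And>x y. x \<notin> K \<or> y \<notin> K \<Longrightarrow> F x y = 0"
    and k: "k \<in> C00_plus" "\<And>x. x \<in> K \<Longrightarrow> k x = 1" and e: "0 < e"
  obtains S and q :: "'a \<Rightarrow> 'a \<Rightarrow> real" where "finite S" "\<And>s. s \<in> S \<Longrightarrow> q s \<in> C00_plus"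
    "\<And>x y. \<bar>F x y - (\<Sum>s\<in>S. F x s * q s y)\<bar> \<le> e * (k x * k y)"
proof -
  have k0: "0 \<le> k x" for x using C00_plus_nonneg[OF k(1)] .
  have F': "continuous_on UNIV (\<lambda>(y, x). F x y)"
    by (rule continuous_on_swap_arguments[OF F(1)])
  have "\<exists>W. open W \<and> s \<in> W \<and> (\<forall>y\<in>W. \<forall>x\<in>K. \<bar>F x y - F x s\<bar> < e)" for s
    using equicontinuous_over_compact[OF F' K e] by metis
  then obtain W where W: "\<And>s. open (W s) \<and> s \<in> W s"
    "\<And>s x y. y \<in> W s \<Longrightarrow> x \<in> K \<Longrightarrow> \<bar>F x y - F x s\<bar> < e"
    by metis
  obtain S and h :: "'a \<Rightarrow> 'a \<Rightarrow> real" where S: "finite S" "S \<subseteq> K" and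
    h: "\<And>s. s \<in> S \<Longrightarrow> h s \<in> C00_plus" "\<And>s y. s \<in> S \<Longrightarrow> y \<notin> W s \<Longrightarrow> h s y = 0"
    "\<And>y. y \<in> K \<Longrightarrow> (\<Sum>s\<in>S. h s y) = 1" "\<And>y. (\<Sum>s\<in>S. h s y) \<le> 1"
    by (rule partition_of_unity[OF K W(1)]) (rule that)
  \<comment> \<open>The factor \<open>k\<close> confines the approximation to a support that does not depend on \<open>e\<close>.\<close>
  define q where "q s y = k y * h s y" for s y
  have q: "q s \<in> C00_plus" if "s \<in> S" for s
    unfolding q_def using h(1)[OF that]
    by (intro C00_plus_mult k C00_plus_continuous C00_plus_nonneg)
  have sum_q: "(\<Sum>s\<in>S. q s y) = k y * (\<Sum>s\<in>S. h s y)" for y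
    by (simp add: q_def sum_distrib_left)
  have "\<bar>F x y - (\<Sum>s\<in>S. F x s * q s y)\<bar> \<le> e * (k x * k y)" for x y
  proof (cases "x \<in> K")
    case True
    have "F x y = F x y * (\<Sum>s\<in>S. q s y)"
    proof (cases "y \<in> K")
      case True
      then show ?thesis unfolding sum_q using h(3) k(2) by simp
    qed (simp add: F(2))
    then have "F x y - (\<Sum>s\<in>S. F x s * q s y) = (\<Sum>s\<in>S. (F x y - F x s) * q s y)"
      by (simp add: sum_distrib_left left_diff_distrib sum_subtractf)
    also have "\<bar>\<dots>\<bar> \<le> (\<Sum>s\<in>S. e * q s y)"
    proof (rule order_trans[OF sum_abs sum_mono])
      fix s assume s: "s \<in> S"
      show "\<bar>(F x y - F x s) * q s y\<bar> \<le> e * q s y"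
      proof (cases "y \<in> W s")
        case True
        show ?thesis
          using W(2)[OF True \<open>x \<in> K\<close>] C00_plus_nonneg[OF q[OF s], of y]
          by (simp add: abs_mult mult_right_mono)
      next
        case False
        then show ?thesis using h(2)[OF s] by (simp add: q_def)
      qed
    qed
    also have "\<dots> = e * (k y * (\<Sum>s\<in>S. h s y))" by (simp only: sum_q flip: sum_distrib_left)
    also have "\<dots> \<le> e * (k y * 1)"
      using e by (intro mult_left_mono h(4) k0) simp
    finally show ?thesis using k(2)[OF True] by simp
  next
    case False
    then have "F x y - (\<Sum>s\<in>S. F x s * q s y) = 0" by (simp add: F(2))
    then show ?thesis using e k0[of x] k0[of y] by simp
  qed
  with S(1) q show thesis by (rule that)
qed

text \<open>A Fubini theorem that needs no measure: \<open>F\<close> is uniformly close to a finite sum of products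
  \<open>F x s * q s y\<close>, for which the two iterated functionals agree by linearity, and a common bound
  on the support of the error makes its contribution small.\<close>
theorem positive_functional_Fubini:
  fixes F :: "'a \<Rightarrow> 'a \<Rightarrow> real"
  assumes J: "positive_functional J" and H: "positive_functional H" and K: "compact K"
    and F: "continuous_on UNIV (\<lambda>(x, y). F x y)" "\<And>x y. 0 \<le> F x y"
      "\<And>x y. x \<notin> K \<or> y \<notin> K \<Longrightarrow> F x y = 0"
  shows "H (\<lambda>x. J (\<lambda>y. F x y)) = J (\<lambda>y. H (\<lambda>x. F x y))"
proof -
  have F': "continuous_on UNIV (\<lambda>(y, x). F x y)"
    by (rule continuous_on_swap_arguments[OF F(1)])
  have sec: "F x \<in> C00_plus" "(\<lambda>x. F x y) \<in> C00_plus" for x y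
    by (rule C00_plus_section[OF F(1,2) K], simp add: F(3))
      (rule C00_plus_section[OF F' F(2) K], simp add: F(3))
  have JF: "(\<lambda>x. J (F x)) \<in> C00_plus"
    using functional_of_sections_in_C00_plus[OF J K F] .
  have HF: "(\<lambda>y. H (\<lambda>x. F x y)) \<in> C00_plus"
    by (rule functional_of_sections_in_C00_plus[OF H K F' F(2)]) (rule F(3), blast)
  obtain k where k: "k \<in> C00_plus" "\<And>x. x \<in> K \<Longrightarrow> k x = 1"
    by (rule ex_cutoff[OF K]) (rule that)
  have k0: "0 \<le> k x" for x using C00_plus_nonneg[OF k(1)] .
  have Jk: "0 \<le> J k" and Hk: "0 \<le> H k"
    by (rule positive_functional_nonneg[OF J k(1)], rule positive_functional_nonneg[OF H k(1)])
  have close: "\<bar>H (\<lambda>x. J (F x)) - J (\<lambda>y. H (\<lambda>x. F x y))\<bar> \<le> 2 * e * (J k * H k)"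
    if e: "0 < e" for e
  proof -
    obtain S and q :: "'a \<Rightarrow> 'a \<Rightarrow> real" where S: "finite S"
      and q: "\<And>s. s \<in> S \<Longrightarrow> q s \<in> C00_plus"
      and approx: "\<And>x y. \<bar>F x y - (\<Sum>s\<in>S. F x s * q s y)\<bar> \<le> e * (k x * k y)"
      by (rule uniform_product_approximation[OF K F(1,3) k e]) (assumption | rule that)+
    have q0: "0 \<le> q s y" if "s \<in> S" for s y using C00_plus_nonneg[OF q[OF that]] .
    have Jq: "0 \<le> J (q s)" if "s \<in> S" for s using positive_functional_nonneg[OF J q[OF that]] .
    have HFs: "0 \<le> H (\<lambda>x. F x s)" for s using positive_functional_nonneg[OF H sec(2)] .
    define A where "A = (\<Sum>s\<in>S. J (q s) * H (\<lambda>x. F x s))"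
    have "\<bar>J (F x) - (\<Sum>s\<in>S. J (q s) * F x s)\<bar> \<le> (e * J k) * k x" for x
    proof -
      have "\<bar>J (F x) - J (\<lambda>y. \<Sum>s\<in>S. F x s * q s y)\<bar> \<le> (e * k x) * J k"
      proof (rule positive_functional_diff[OF J sec(1) _ k(1)])
        show "(\<lambda>y. \<Sum>s\<in>S. F x s * q s y) \<in> C00_plus"
          by (rule positive_combination_in_C00_plus[OF S q F(2)])
        show "\<bar>F x y - (\<Sum>s\<in>S. F x s * q s y)\<bar> \<le> (e * k x) * k y" for y
          using approx[of x y] by (simp only: mult.assoc)
      qed (use e k0 in simp)
      also have "J (\<lambda>y. \<Sum>s\<in>S. F x s * q s y) = (\<Sum>s\<in>S. F x s * J (q s))"
        by (rule positive_functional_combination[OF J S q F(2)])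
      finally show ?thesis by (simp only: mult_ac)
    qed
    then have "\<bar>H (\<lambda>x. J (F x)) - H (\<lambda>x. \<Sum>s\<in>S. J (q s) * F x s)\<bar> \<le> (e * J k) * H k"
      using e Jk
      by (intro positive_functional_diff[OF H JF positive_combination_in_C00_plus[OF S sec(2) Jq] k(1)])
        simp_all
    also have "H (\<lambda>x. \<Sum>s\<in>S. J (q s) * F x s) = A"
      unfolding A_def by (rule positive_functional_combination[OF H S sec(2) Jq])
    finally have HJ: "\<bar>H (\<lambda>x. J (F x)) - A\<bar> \<le> e * J k * H k" .
    have "\<bar>H (\<lambda>x. F x y) - (\<Sum>s\<in>S. H (\<lambda>x. F x s) * q s y)\<bar> \<le> (e * H k) * k y" for y
    proof -
      have "\<bar>H (\<lambda>x. F x y) - H (\<lambda>x. \<Sum>s\<in>S. q s y * F x s)\<bar> \<le> (e * k y) * H k"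
      proof (rule positive_functional_diff[OF H sec(2) _ k(1)])
        show "(\<lambda>x. \<Sum>s\<in>S. q s y * F x s) \<in> C00_plus"
          by (rule positive_combination_in_C00_plus[OF S sec(2) q0])
        show "\<bar>F x y - (\<Sum>s\<in>S. q s y * F x s)\<bar> \<le> (e * k y) * k x" for x
          using approx[of x y] by (simp only: mult_ac)
      qed (use e k0 in simp)
      also have "H (\<lambda>x. \<Sum>s\<in>S. q s y * F x s) = (\<Sum>s\<in>S. q s y * H (\<lambda>x. F x s))"
        by (rule positive_functional_combination[OF H S sec(2) q0])
      finally show ?thesis by (simp only: mult_ac)
    qed
    then have "\<bar>J (\<lambda>y. H (\<lambda>x. F x y)) - J (\<lambda>y. \<Sum>s\<in>S. H (\<lambda>x. F x s) * q s y)\<bar> \<le> (e * H k) * J k"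
      using e Hk
      by (intro positive_functional_diff[OF J HF positive_combination_in_C00_plus[OF S q HFs] k(1)])
        simp_all
    also have "J (\<lambda>y. \<Sum>s\<in>S. H (\<lambda>x. F x s) * q s y) = A"
      unfolding A_def by (subst positive_functional_combination[OF J S q HFs]) (simp_all only: mult_ac)
    finally have "\<bar>J (\<lambda>y. H (\<lambda>x. F x y)) - A\<bar> \<le> e * J k * H k" by (simp only: mult_ac)
    with HJ show ?thesis by linarith
  qed
  have "\<bar>H (\<lambda>x. J (F x)) - J (\<lambda>y. H (\<lambda>x. F x y))\<bar> \<le> 0"
  proof (rule field_le_epsilon)
    fix d :: real assume d: "0 < d"
    define M where "M = J k * H k"
    have M: "0 \<le> M" using Jk Hk by (simp add: M_def)
    have "2 * (d / (2 * (M + 1))) * M \<le> d" using d M by (simp add: field_simps)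
    then show "\<bar>H (\<lambda>x. J (F x)) - J (\<lambda>y. H (\<lambda>x. F x y))\<bar> \<le> 0 + d"
      using close[of "d / (2 * (M + 1))", folded M_def] d M by simp
  qed
  then show ?thesis by simp
qed

end

end

section \<open>The fan is normal\<close>

context loop
begin

lemma unit_left [simp]: "\<e> \<cdot> x = x" and unit_right [simp]: "x \<cdot> \<e> = x"
proof -
  obtain e where e: "\<forall>g. e \<cdot> g = g \<and> g \<cdot> e = g" using ex_unit by blast
  have "\<e> = e" unfolding unit_def
    using e by (rule the_equality) (metis e)
  with e show "\<e> \<cdot> x = x" "x \<cdot> \<e> = x" by auto
qed

lemma mul_ldiv [simp]: "a \<cdot> ldiv a b = b"
  unfolding ldiv_def by (rule theI'[OF ex1_left_quotient])

lemma rdiv_mul [simp]: "rdiv b a \<cdot> a = b"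
  unfolding rdiv_def by (rule theI'[OF ex1_right_quotient])

lemma mul_left_cancel [simp]: "a \<cdot> x = a \<cdot> y \<longleftrightarrow> x = y"
  using ex1_left_quotient by metis

lemma mul_right_cancel [simp]: "x \<cdot> a = y \<cdot> a \<longleftrightarrow> x = y"
  using ex1_right_quotient by metis

lemma ldiv_eqI: "a \<cdot> x = b \<Longrightarrow> ldiv a b = x"
  by (metis mul_left_cancel mul_ldiv)

lemma rdiv_eqI: "y \<cdot> a = b \<Longrightarrow> rdiv b a = y"
  by (metis mul_right_cancel rdiv_mul)

lemma ldiv_mul [simp]: "ldiv a (a \<cdot> b) = b"
  by (rule ldiv_eqI) (rule refl)

lemma rdiv_cancel [simp]: "rdiv (a \<cdot> b) b = a"
  by (rule rdiv_eqI) (rule refl)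

lemma nucleus_assoc:
  assumes "n \<in> nucleus"
  shows "(n \<cdot> b) \<cdot> c = n \<cdot> (b \<cdot> c)" "(b \<cdot> n) \<cdot> c = b \<cdot> (n \<cdot> c)" "(b \<cdot> c) \<cdot> n = b \<cdot> (c \<cdot> n)"
  using assms by (auto simp: nucleus_def)

lemma is_subgroup_unit: "is_subgroup S \<Longrightarrow> \<e> \<in> S"
  unfolding is_subgroup_def using monoid.one_closed[OF group.is_monoid] by fastforce

lemma is_subgroup_mul: "is_subgroup S \<Longrightarrow> a \<in> S \<Longrightarrow> b \<in> S \<Longrightarrow> a \<cdot> b \<in> S"
  unfolding is_subgroup_def using monoid.m_closed[OF group.is_monoid] by fastforce

lemma is_subgroup_inverse:
  assumes "is_subgroup S" "a \<in> S"
  obtains b where "b \<in> S" "b \<cdot> a = \<e>" "a \<cdot> b = \<e>"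
proof -
  interpret group "\<lparr>carrier = S, monoid.mult = (\<cdot>), one = \<e>\<rparr>"
    using assms(1) by (simp add: is_subgroup_def)
  show thesis
    by (rule that[of "inv\<^bsub>\<lparr>carrier = S, monoid.mult = (\<cdot>), one = \<e>\<rparr>\<^esub> a"])
      (use assms(2) inv_closed[of a] l_inv[of a] r_inv[of a] in auto)
qed

lemma is_subgroupI:
  assumes "S \<subseteq> nucleus" "\<e> \<in> S" "\<And>a b. a \<in> S \<Longrightarrow> b \<in> S \<Longrightarrow> a \<cdot> b \<in> S"
    and "\<And>a. a \<in> S \<Longrightarrow> \<exists>b\<in>S. b \<cdot> a = \<e>"
  shows "is_subgroup S"
  unfolding is_subgroup_def using assms nucleus_assoc(1) by (intro groupI) auto

definition normalizing :: "'a set \<Rightarrow> bool"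
  where "normalizing N \<longleftrightarrow> (\<forall>n\<in>N. \<forall>a. \<exists>m\<in>N. n \<cdot> a = a \<cdot> m)"

text \<open>With \<open>a a' = \<e>\<close>, moving \<open>n\<close> across \<open>a'\<close> from left to right moves it across \<open>a\<close> from right to
  left.\<close>
lemma normalizing_right:
  assumes N: "normalizing N" "N \<subseteq> nucleus" and n: "n \<in> N"
  obtains m where "m \<in> N" "a \<cdot> n = m \<cdot> a"
proof -
  define a' where "a' = ldiv a \<e>"
  obtain m where m: "m \<in> N" "n \<cdot> a' = a' \<cdot> m" using N n unfolding normalizing_def by blast
  have nm: "n \<in> nucleus" "m \<in> nucleus" using N n m by auto
  have "(a \<cdot> n) \<cdot> a' = (m \<cdot> a) \<cdot> a'"
    using nucleus_assoc(2)[OF nm(1), of a a'] nucleus_assoc(3)[OF nm(2), of a a']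
      nucleus_assoc(1)[OF nm(2), of a a'] m(2)
    by (simp add: a'_def)
  then show thesis using that m(1) by simp
qed

end

context fan_loop
begin

lemma t_in_nucleus: "t a b c \<in> nucleus" and t_eq: "(a \<cdot> b) \<cdot> c = t a b c \<cdot> (a \<cdot> (b \<cdot> c))"
proof -
  have "\<exists>!s. s \<in> nucleus \<and> (a \<cdot> b) \<cdot> c = s \<cdot> (a \<cdot> (b \<cdot> c))"
    using ex_t[of a b c] by (metis mul_right_cancel)
  from theI'[OF this] show "t a b c \<in> nucleus" "(a \<cdot> b) \<cdot> c = t a b c \<cdot> (a \<cdot> (b \<cdot> c))"
    by (auto simp: t_def)
qed

lemma p_in_nucleus: "p a b c \<in> nucleus" and p_eq: "(a \<cdot> b) \<cdot> c = (a \<cdot> (b \<cdot> c)) \<cdot> p a b c"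
proof -
  have "\<exists>!s. s \<in> nucleus \<and> (a \<cdot> b) \<cdot> c = (a \<cdot> (b \<cdot> c)) \<cdot> s"
    using ex_p[of a b c] by (metis mul_left_cancel)
  from theI'[OF this] show "p a b c \<in> nucleus" "(a \<cdot> b) \<cdot> c = (a \<cdot> (b \<cdot> c)) \<cdot> p a b c"
    by (auto simp: p_def)
qed

text \<open>Up to an element of \<open>N\<close> on the right, \<open>((a b) c) d\<close> equals \<open>a (b (c d))\<close>. It also equals
  \<open>(a (b c)) (p d)\<close>, where \<open>p\<close> is \<open>p a b c\<close>, and hence \<open>a (b (c (p d)))\<close> up to an element of \<open>N\<close>.
  Cancelling \<open>a\<close>, \<open>b\<close> and \<open>c\<close> compares \<open>p d\<close> with \<open>d\<close>.\<close>
lemma p_normalizing: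
  assumes N: "is_subgroup N" "N \<subseteq> nucleus" and p: "\<And>a b c. p a b c \<in> N"
  shows "\<exists>m\<in>N. p a b c \<cdot> d = d \<cdot> m"
proof -
  have "((a \<cdot> b) \<cdot> c) \<cdot> d = ((a \<cdot> b) \<cdot> (c \<cdot> d)) \<cdot> p (a \<cdot> b) c d" by (rule p_eq)
  also have "\<dots> = ((a \<cdot> (b \<cdot> (c \<cdot> d))) \<cdot> p a b (c \<cdot> d)) \<cdot> p (a \<cdot> b) c d"
    by (subst p_eq[of a b "c \<cdot> d"]) (rule refl)
  also have "\<dots> = (a \<cdot> (b \<cdot> (c \<cdot> d))) \<cdot> (p a b (c \<cdot> d) \<cdot> p (a \<cdot> b) c d)"
    by (rule nucleus_assoc(3)[OF p_in_nucleus])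
  finally obtain m1 where m1: "m1 \<in> N"
      "((a \<cdot> b) \<cdot> c) \<cdot> d = (a \<cdot> (b \<cdot> (c \<cdot> d))) \<cdot> m1"
    using is_subgroup_mul[OF N(1)] p by blast
  define w where "w = p a b c \<cdot> d"
  have "((a \<cdot> b) \<cdot> c) \<cdot> d = (a \<cdot> (b \<cdot> c)) \<cdot> w"
    unfolding w_def using p_eq[of a b c] nucleus_assoc(2)[OF p_in_nucleus] by metis
  also have "\<dots> = (a \<cdot> ((b \<cdot> c) \<cdot> w)) \<cdot> p a (b \<cdot> c) w" by (rule p_eq)
  also have "\<dots> = (a \<cdot> ((b \<cdot> (c \<cdot> w)) \<cdot> p b c w)) \<cdot> p a (b \<cdot> c) w"
    by (subst p_eq[of b c w]) (rule refl)
  also have "\<dots> = (a \<cdot> (b \<cdot> (c \<cdot> w))) \<cdot> (p b c w \<cdot> p a (b \<cdot> c) w)"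
    by (metis nucleus_assoc(3)[OF p_in_nucleus])
  finally obtain m2 where m2: "m2 \<in> N" "((a \<cdot> b) \<cdot> c) \<cdot> d = (a \<cdot> (b \<cdot> (c \<cdot> w))) \<cdot> m2"
    using is_subgroup_mul[OF N(1)] p by blast
  obtain m3 where m3: "m3 \<in> N" "m2 \<cdot> m3 = \<e>" using is_subgroup_inverse[OF N(1) m2(1)] by metis
  define m where "m = m1 \<cdot> m3"
  have m: "m \<in> N" unfolding m_def using is_subgroup_mul[OF N(1)] m1 m3 by blast
  have nuc: "m1 \<in> nucleus" "m2 \<in> nucleus" "m3 \<in> nucleus" "m \<in> nucleus" using N m1 m2 m3 m by auto
  have "a \<cdot> (b \<cdot> (c \<cdot> w)) = ((a \<cdot> (b \<cdot> (c \<cdot> w))) \<cdot> m2) \<cdot> m3"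
    using nucleus_assoc(2)[OF nuc(2)] m3 by simp
  also have "\<dots> = ((a \<cdot> (b \<cdot> (c \<cdot> d))) \<cdot> m1) \<cdot> m3" using m1 m2 by simp
  also have "\<dots> = (a \<cdot> (b \<cdot> (c \<cdot> d))) \<cdot> m" unfolding m_def by (rule nucleus_assoc(2)[OF nuc(1)])
  also have "\<dots> = a \<cdot> (b \<cdot> (c \<cdot> (d \<cdot> m)))" using nucleus_assoc(3)[OF nuc(4)] by simp
  finally have "w = d \<cdot> m" by simp
  with m show ?thesis unfolding w_def by blast
qed

text \<open>Here \<open>t x = x p\<close> for \<open>x = a (b c)\<close>, and every \<open>y\<close> is a multiple \<open>x z\<close> of that \<open>x\<close>, so the property
  passes from \<open>p\<close> to \<open>t\<close>.\<close>
lemma t_normalizing: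
  assumes N: "is_subgroup N" "N \<subseteq> nucleus" and p: "\<And>a b c. p a b c \<in> N"
  shows "\<exists>m\<in>N. t a b c \<cdot> y = y \<cdot> m"
proof -
  define x where "x = a \<cdot> (b \<cdot> c)"
  define z where "z = ldiv x y"
  have y: "y = x \<cdot> z" by (simp add: z_def)
  have tx: "t a b c \<cdot> x = x \<cdot> p a b c" unfolding x_def using t_eq p_eq by metis
  obtain m where m: "m \<in> N" "p a b c \<cdot> z = z \<cdot> m" using p_normalizing[OF N p] by blast
  have "t a b c \<cdot> y = (t a b c \<cdot> x) \<cdot> z" using y nucleus_assoc(1)[OF t_in_nucleus] by simp
  also have "\<dots> = x \<cdot> (z \<cdot> m)"
    using nucleus_assoc(2)[OF p_in_nucleus] m(2) by (simp add: tx)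
  also have "\<dots> = y \<cdot> m" using nucleus_assoc(3)[of m x z] m(1) N(2) y by auto
  finally show ?thesis using m(1) by blast
qed

end

context topological_fan_loop
begin

lemmas continuous_on_mul = continuous_on_compose_pair[OF continuous_mul]
  and continuous_on_ldiv = continuous_on_compose_pair[OF continuous_ldiv]
  and continuous_on_rdiv = continuous_on_compose_pair[OF continuous_rdiv]

lemma closed_fan: "closed fan"
  unfolding fan_def hull_def by (intro closed_Inter) auto

lemma t_in_fan: "t a b c \<in> fan" and p_in_fan: "p a b c \<in> fan"
  unfolding fan_def by (rule subsetD[OF hull_subset], blast)+

lemma fan_minimal:
  assumes "closed S" "is_subgroup S" "\<And>a b c. t a b c \<in> S" "\<And>a b c. p a b c \<in> S"
  shows "fan \<subseteq> S"
  unfolding fan_def by (rule hull_minimal) (use assms in auto)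

text \<open>The elements of the fan that can be moved across every element of the loop form a closed
  subgroup containing all \<open>t a b c\<close> and \<open>p a b c\<close>, so by minimality they are the whole fan.\<close>
theorem fan_normalizing:
  assumes N: "is_subgroup fan" "fan \<subseteq> nucleus"
  shows "normalizing fan"
proof -
  define S where "S = {n \<in> fan. \<forall>a. \<exists>m\<in>fan. n \<cdot> a = a \<cdot> m}"
  have iff: "(\<exists>m\<in>fan. b = a \<cdot> m) \<longleftrightarrow> ldiv a b \<in> fan" for a b
  proof
    assume "\<exists>m\<in>fan. b = a \<cdot> m"
    then show "ldiv a b \<in> fan" using ldiv_eqI by auto
  next
    assume "ldiv a b \<in> fan"
    then show "\<exists>m\<in>fan. b = a \<cdot> m" by (intro bexI[of _ "ldiv a b"]) simp_all
  qed
  have S_alt: "S = fan \<inter> (\<Inter>a. (\<lambda>n. ldiv a (n \<cdot> a)) -` fan)"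
    unfolding S_def iff by (simp add: set_eq_iff)
  have "closed S"
    unfolding S_alt
    by (intro closed_Int closed_fan closed_INT ballI closed_vimage
        continuous_on_ldiv continuous_on_mul continuous_on_const continuous_on_id)
  moreover have "is_subgroup S"
  proof (rule is_subgroupI)
    show "S \<subseteq> nucleus" using N(2) by (auto simp: S_def)
    have "\<exists>m\<in>fan. \<e> \<cdot> a = a \<cdot> m" for a
      using is_subgroup_unit[OF N(1)] by (intro bexI[of _ "\<e>"]) simp_all
    then show "\<e> \<in> S" using is_subgroup_unit[OF N(1)] by (simp add: S_def)
  next
    fix n k assume n: "n \<in> S" and k: "k \<in> S"
    have "\<exists>m\<in>fan. (n \<cdot> k) \<cdot> a = a \<cdot> m" for a
    proof -
      obtain i where i: "i \<in> fan" "k \<cdot> a = a \<cdot> i" using k by (auto simp: S_def)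
      obtain j where j: "j \<in> fan" "n \<cdot> a = a \<cdot> j" using n by (auto simp: S_def)
      have nuc: "n \<in> nucleus" "i \<in> nucleus" "j \<in> nucleus" using n i j N by (auto simp: S_def)
      have "(n \<cdot> k) \<cdot> a = (n \<cdot> a) \<cdot> i" using nucleus_assoc(1)[OF nuc(1)] i by simp
      also have "\<dots> = a \<cdot> (j \<cdot> i)" using nucleus_assoc(2)[OF nuc(3)] j by simp
      finally show ?thesis using is_subgroup_mul[OF N(1) j(1) i(1)] by blast
    qed
    then show "n \<cdot> k \<in> S" using n k is_subgroup_mul[OF N(1)] by (auto simp: S_def)
  next
    fix n assume n: "n \<in> S"
    then obtain k where k: "k \<in> fan" "k \<cdot> n = \<e>" "n \<cdot> k = \<e>"
      using is_subgroup_inverse[OF N(1)] unfolding S_def by blast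
    have "\<exists>m\<in>fan. k \<cdot> a = a \<cdot> m" for a
    proof -
      obtain j where j: "j \<in> fan" "n \<cdot> (k \<cdot> a) = (k \<cdot> a) \<cdot> j" using n by (auto simp: S_def)
      obtain i where i: "i \<in> fan" "j \<cdot> i = \<e>" using is_subgroup_inverse[OF N(1) j(1)] by metis
      have nuc: "n \<in> nucleus" "j \<in> nucleus" using n j N by (auto simp: S_def)
      have "a = (k \<cdot> a) \<cdot> j" using j(2) nucleus_assoc(1)[OF nuc(1), of k a] k by simp
      then have "a \<cdot> i = k \<cdot> a" using nucleus_assoc(2)[OF nuc(2), of "k \<cdot> a" i] i by simp
      then show ?thesis using i by metis
    qed
    with k show "\<exists>k\<in>S. k \<cdot> n = \<e>" by (auto simp: S_def)
  qed
  moreover have "t a b c \<in> S" "p a b c \<in> S" for a b c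
    unfolding S_def using t_in_fan p_in_fan t_normalizing[OF N p_in_fan] p_normalizing[OF N p_in_fan]
    by auto
  ultimately have "fan \<subseteq> S" by (rule fan_minimal)
  then show ?thesis unfolding S_def normalizing_def by blast
qed

end

section \<open>Left invariant functionals and averaging over the fan\<close>

locale compact_fan_loop = topological_fan_loop mul
  for mul :: "'a::t1_space \<Rightarrow> 'a \<Rightarrow> 'a"  (infixl \<open>\<cdot>\<close> 70) +
  assumes locally_compact: "locally_compact_space (euclidean :: 'a topology)"
    and compact_fan: "compact fan"
    and fan_subgroup: "is_subgroup fan"
    and fan_nucleus: "fan \<subseteq> nucleus"
begin

text \<open>The diagonal is the preimage of the closed point \<open>\<e>\<close> under left division.\<close>
lemma hausdorff: "Hausdorff_space (euclidean :: 'a topology)"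
proof -
  have "\<exists>U V. open U \<and> open V \<and> x \<in> U \<and> y \<in> V \<and> disjnt U V" if xy: "x \<noteq> y" for x y :: 'a
  proof -
    define D where "D = (\<lambda>z. ldiv (fst z) (snd z)) -` (- {\<e>})"
    have "continuous_on UNIV (\<lambda>z. ldiv (fst z) (snd z))"
      by (rule continuous_on_ldiv) (intro continuous_intros)+
    then have "open D" unfolding D_def by (intro open_vimage) auto
    moreover have "ldiv x y \<noteq> \<e>" using xy by (metis mul_ldiv unit_right)
    then have "(x, y) \<in> D" by (simp add: D_def)
    ultimately obtain U V where UV: "open U" "open V" "(x, y) \<in> U \<times> V" "U \<times> V \<subseteq> D"
      by (rule open_prod_elim)
    have "ldiv z z = \<e>" for z by (rule ldiv_eqI) simp
    then have "(z, z) \<notin> D" for z by (simp add: D_def)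
    then have "disjnt U V" using UV(4) unfolding disjnt_iff by blast
    then show ?thesis using UV by blast
  qed
  then show ?thesis unfolding Hausdorff_space_def by simp
qed

lemmas C00_plusI = C00_plusI[OF hausdorff]
  and C00_plus_mult = C00_plus_mult[OF hausdorff]
  and C00_plus_scale = C00_plus_scale[OF hausdorff]
  and C00_plus_positive_part = C00_plus_positive_part[OF hausdorff]
  and C00_plus_section = C00_plus_section[OF hausdorff]
  and functional_of_sections_in_C00_plus =
    functional_of_sections_in_C00_plus[OF hausdorff locally_compact]
  and positive_functional_Fubini = positive_functional_Fubini[OF hausdorff locally_compact]

lemma C00_plus_left_quotient:
  assumes f: "f \<in> C00_plus"
  shows "(\<lambda>x. f (ldiv b x)) \<in> C00_plus"
proof -
  obtain K where K: "compact K" "\<And>x. x \<notin> K \<Longrightarrow> f x = 0" using C00_plus_support[OF f] by metis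
  have b: "continuous_on A (\<lambda>x. b \<cdot> x)" for A
    by (rule continuous_on_mul) (intro continuous_intros)+
  show ?thesis
  proof (rule C00_plusI)
    show "continuous_on UNIV (\<lambda>x. f (ldiv b x))"
      by (rule continuous_on_compose2[OF C00_plus_continuous[OF f]], rule continuous_on_ldiv)
        (intro continuous_intros subset_UNIV)+
    show "compact ((\<lambda>x. b \<cdot> x) ` K)" by (rule compact_continuous_image[OF b K(1)])
    show "f (ldiv b x) = 0" if "x \<notin> (\<lambda>x. b \<cdot> x) ` K" for x
      using that mul_ldiv[of b x] by (intro K(2)) (metis imageI)
  qed (rule C00_plus_nonneg[OF f])
qed

lemma C00_plus_inversion:
  assumes f: "f \<in> C00_plus"
  shows "(\<lambda>x. f (ldiv x \<e>)) \<in> C00_plus"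
proof -
  obtain K where K: "compact K" "\<And>x. x \<notin> K \<Longrightarrow> f x = 0" using C00_plus_support[OF f] by metis
  have r: "continuous_on A (\<lambda>w. rdiv \<e> w)" for A
    by (rule continuous_on_rdiv) (intro continuous_intros)+
  show ?thesis
  proof (rule C00_plusI)
    show "continuous_on UNIV (\<lambda>x. f (ldiv x \<e>))"
      by (rule continuous_on_compose2[OF C00_plus_continuous[OF f]], rule continuous_on_ldiv)
        (intro continuous_intros subset_UNIV)+
    show "compact ((\<lambda>w. rdiv \<e> w) ` K)" by (rule compact_continuous_image[OF r K(1)])
    show "f (ldiv x \<e>) = 0" if "x \<notin> (\<lambda>w. rdiv \<e> w) ` K" for x
    proof -
      have "rdiv \<e> (ldiv x \<e>) = x" by (rule rdiv_eqI) simp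
      then show ?thesis using that by (intro K(2)) (metis imageI)
    qed
  qed (rule C00_plus_nonneg[OF f])
qed

lemma left_invariant_functional_positive:
  assumes F: "left_invariant_functional mul F"
  shows "positive_functional F"
proof -
  have lin: "F (\<lambda>x. \<Sum>i = 1..n. \<alpha> i * f i x) = (\<Sum>i = 1..n. \<alpha> i * F (f i))"
    if "1 \<le> n" "\<And>i. f i \<in> C00_plus" "\<And>i. 0 \<le> \<alpha> i" for n :: nat and f \<alpha>
    using F that unfolding left_invariant_functional_def by blast
  have "F (\<lambda>x. f x + g x) = F f + F g" if "f \<in> C00_plus" "g \<in> C00_plus" for f g
    using lin[of 2 "\<lambda>i. if i = 1 then f else g" "\<lambda>_. 1"] that by (simp add: numeral_2_eq_2)
  moreover have "F (\<lambda>x. c * f x) = c * F f" if "f \<in> C00_plus" "0 \<le> c" for f c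
    using lin[of 1 "\<lambda>_. f" "\<lambda>_. c"] that by simp
  ultimately show ?thesis
    using F unfolding positive_functional_def left_invariant_functional_def by blast
qed

lemma left_invariant_functional_strict:
  assumes F: "left_invariant_functional mul F" and f: "f \<in> C00_plus" "0 < f x"
  shows "0 < F f"
proof -
  have "f \<noteq> (\<lambda>x. 0)" using f(2) by auto
  then show ?thesis using F f(1) unfolding left_invariant_functional_def by blast
qed

lemma left_invariant_functional_translate:
  assumes "left_invariant_functional mul F" "f \<in> C00_plus"
  shows "F (\<lambda>x. f (b \<cdot> x)) = F f"
  using assms unfolding left_invariant_functional_def by blast

lemma left_invariant_functional_left_quotient:
  assumes F: "left_invariant_functional mul F" and f: "f \<in> C00_plus"
  shows "F (\<lambda>x. f (ldiv b x)) = F f"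
  using left_invariant_functional_translate[OF F C00_plus_left_quotient[OF f, of b], of b] by simp

definition fan_invariant :: "('a \<Rightarrow> real) \<Rightarrow> bool"
  where "fan_invariant f \<longleftrightarrow> (\<forall>n\<in>fan. \<forall>x. f (n \<cdot> x) = f x)"

lemma fan_invariantD: "fan_invariant f \<Longrightarrow> n \<in> fan \<Longrightarrow> f (n \<cdot> x) = f x"
  by (simp add: fan_invariant_def)

lemma fan_invariant_right:
  assumes f: "fan_invariant f" and n: "n \<in> fan"
  shows "f (x \<cdot> n) = f x"
proof -
  obtain m where "m \<in> fan" "x \<cdot> n = m \<cdot> x"
    using normalizing_right[OF fan_normalizing[OF fan_subgroup fan_nucleus] fan_nucleus n] by metis
  then show ?thesis using fan_invariantD[OF f] by simp
qed

lemma fan_assoc: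
  assumes "n \<in> fan"
  shows "(n \<cdot> b) \<cdot> c = n \<cdot> (b \<cdot> c)" "(b \<cdot> n) \<cdot> c = b \<cdot> (n \<cdot> c)" "(b \<cdot> c) \<cdot> n = b \<cdot> (c \<cdot> n)"
  using assms fan_nucleus by (auto intro: nucleus_assoc)

text \<open>The next three lemmas are the group laws \<open>(x z)\<^sup>-\<^sup>1 x = z\<^sup>-\<^sup>1\<close>, \<open>(z\<^sup>-\<^sup>1)\<^sup>-\<^sup>1 = z\<close> and
  \<open>(n z)\<^sup>-\<^sup>1 = z\<^sup>-\<^sup>1\<close> for \<open>n\<close> in the fan, as seen by the functions that live on the quotient by the
  fan.\<close>
lemma fan_invariant_quotient:
  assumes f: "fan_invariant f"
  shows "f (ldiv (x \<cdot> z) x) = f (ldiv z \<e>)"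
proof -
  define w where "w = ldiv z \<e>"
  define v where "v = ldiv (x \<cdot> z) x"
  define s where "s = t x z w"
  have s: "s \<in> fan" by (simp add: s_def t_in_fan)
  obtain r where r: "r \<in> fan" "s \<cdot> (x \<cdot> z) = (x \<cdot> z) \<cdot> r"
    using fan_normalizing[OF fan_subgroup fan_nucleus] s unfolding normalizing_def by blast
  have "(x \<cdot> z) \<cdot> w = s \<cdot> x" using t_eq[of x z w] by (simp add: s_def w_def)
  also have "\<dots> = s \<cdot> ((x \<cdot> z) \<cdot> v)" by (simp add: v_def)
  also have "\<dots> = (x \<cdot> z) \<cdot> (r \<cdot> v)" using fan_assoc(1)[OF s, of "x \<cdot> z" v] fan_assoc(2)[OF r(1)] r(2)
    by simp
  finally have "w = r \<cdot> v" by simp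
  then show ?thesis using fan_invariantD[OF f r(1)] by (simp add: w_def v_def)
qed

lemma fan_invariant_inversion_twice:
  assumes f: "fan_invariant f"
  shows "f (ldiv (ldiv z \<e>) \<e>) = f z"
proof -
  define w where "w = ldiv z \<e>"
  define v where "v = ldiv w \<e>"
  have "v = t z w v \<cdot> z" using t_eq[of z w v] by (simp add: w_def v_def)
  then have "f v = f z" using fan_invariantD[OF f t_in_fan] by metis
  then show ?thesis by (simp add: v_def w_def)
qed

lemma fan_invariant_inversion:
  assumes f: "fan_invariant f"
  shows "fan_invariant (\<lambda>z. f (ldiv z \<e>))"
  unfolding fan_invariant_def
proof (intro ballI allI)
  fix n x assume n: "n \<in> fan"
  obtain k where k: "k \<in> fan" "n \<cdot> k = \<e>" using is_subgroup_inverse[OF fan_subgroup n] by metis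
  have "(n \<cdot> x) \<cdot> (ldiv x \<e> \<cdot> k) = n \<cdot> ((x \<cdot> ldiv x \<e>) \<cdot> k)"
    using fan_assoc(1)[OF n] fan_assoc(3)[OF k(1), of x "ldiv x \<e>", symmetric] by simp
  then have "ldiv (n \<cdot> x) \<e> = ldiv x \<e> \<cdot> k" using k by (intro ldiv_eqI) simp
  then show "f (ldiv (n \<cdot> x) \<e>) = f (ldiv x \<e>)" using fan_invariant_right[OF f k(1)] by simp
qed

text \<open>Taking the supremum over the left translates by the compact fan turns a bump into an
  invariant one.\<close>
lemma ex_fan_invariant_bump:
  obtains \<beta> where "\<beta> \<in> C00_plus" "fan_invariant \<beta>" "0 < \<beta> \<e>"
proof -
  obtain b :: "'a \<Rightarrow> real" where b: "b \<in> C00_plus" "0 < b \<e>"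
    by (rule ex_bump[OF hausdorff locally_compact open_UNIV UNIV_I])
  obtain K where K: "compact K" "\<And>x. x \<notin> K \<Longrightarrow> b x = 0" using C00_plus_support[OF b(1)] by metis
  define \<beta> where "\<beta> x = (SUP n\<in>fan. b (n \<cdot> x))" for x
  have ne: "fan \<noteq> {}" and unit: "\<e> \<in> fan" using is_subgroup_unit[OF fan_subgroup] by auto
  have mul: "continuous_on UNIV (\<lambda>z. snd z \<cdot> fst z)"
    by (rule continuous_on_mul) (intro continuous_intros)+
  have cont: "continuous_on UNIV (\<lambda>(x, n). b (n \<cdot> x))"
    unfolding case_prod_unfold
    by (rule continuous_on_compose2[OF C00_plus_continuous[OF b(1)] mul subset_UNIV])
  have "continuous_on fan (\<lambda>n. b (n \<cdot> x))" for x
    by (rule continuous_on_compose_pair[OF cont]) (intro continuous_intros)+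
  then have bdd: "bdd_above ((\<lambda>n. b (n \<cdot> x)) ` fan)" for x
    by (intro bounded_imp_bdd_above compact_imp_bounded compact_continuous_image compact_fan)
  have upper: "b (n \<cdot> x) \<le> \<beta> x" if "n \<in> fan" for n x
    unfolding \<beta>_def by (rule cSUP_upper[OF that bdd])
  have least: "\<beta> x \<le> c" if "\<And>n. n \<in> fan \<Longrightarrow> b (n \<cdot> x) \<le> c" for x c
    unfolding \<beta>_def by (rule cSUP_least[OF ne that])
  have nonneg: "0 \<le> \<beta> x" for x
    using order_trans[OF C00_plus_nonneg[OF b(1)] upper[OF unit]] .
  have "(\<beta> \<longlongrightarrow> \<beta> x0) (at x0)" for x0
  proof (rule tendstoI)
    fix e :: real assume e: "0 < e"
    then have e2: "0 < e / 2" by simp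
    obtain W where W: "open W" "x0 \<in> W"
      "\<And>x n. x \<in> W \<Longrightarrow> n \<in> fan \<Longrightarrow> \<bar>b (n \<cdot> x) - b (n \<cdot> x0)\<bar> < e / 2"
      by (rule equicontinuous_over_compact[OF cont compact_fan e2, of x0]) (rule that)
    have "dist (\<beta> x) (\<beta> x0) < e" if x: "x \<in> W" for x
    proof -
      have "\<beta> x \<le> \<beta> x0 + e / 2"
      proof (rule least)
        fix n assume n: "n \<in> fan"
        show "b (n \<cdot> x) \<le> \<beta> x0 + e / 2" using W(3)[OF x n] upper[OF n, of x0] by linarith
      qed
      moreover have "\<beta> x0 \<le> \<beta> x + e / 2"
      proof (rule least)
        fix n assume n: "n \<in> fan"
        show "b (n \<cdot> x0) \<le> \<beta> x + e / 2" using W(3)[OF x n] upper[OF n, of x] by linarith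
      qed
      ultimately show ?thesis using e unfolding dist_real_def by linarith
    qed
    then show "\<forall>\<^sub>F x in at x0. dist (\<beta> x) (\<beta> x0) < e"
      unfolding eventually_at_topological by (intro exI[of _ W]) (simp add: W(1,2))
  qed
  then have "continuous_on UNIV \<beta>" unfolding continuous_on_def by blast
  moreover have "compact ((\<lambda>(n, x). ldiv n x) ` (fan \<times> K))"
    by (rule compact_image_pair[OF continuous_ldiv compact_fan K(1)])
  moreover have "\<beta> x = 0" if "x \<notin> (\<lambda>(n, x). ldiv n x) ` (fan \<times> K)" for x
  proof (rule antisym[OF least nonneg])
    fix n assume n: "n \<in> fan"
    have "n \<cdot> x \<notin> K"
    proof
      assume "n \<cdot> x \<in> K"
      with n have "ldiv n (n \<cdot> x) \<in> (\<lambda>(n, x). ldiv n x) ` (fan \<times> K)" by force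
      with that show False by simp
    qed
    then show "b (n \<cdot> x) \<le> 0" using K(2) by simp
  qed
  ultimately have "\<beta> \<in> C00_plus" using nonneg by (intro C00_plusI[where f = \<beta>])
  moreover have "fan_invariant \<beta>"
    unfolding fan_invariant_def
  proof (intro ballI allI antisym)
    fix m x assume m: "m \<in> fan"
    show "\<beta> (m \<cdot> x) \<le> \<beta> x"
    proof (rule least)
      fix n assume n: "n \<in> fan"
      show "b (n \<cdot> (m \<cdot> x)) \<le> \<beta> x"
        using upper[OF is_subgroup_mul[OF fan_subgroup n m], of x] fan_assoc(1)[OF n] by simp
    qed
    obtain k where k: "k \<in> fan" "k \<cdot> m = \<e>" using is_subgroup_inverse[OF fan_subgroup m] by metis
    show "\<beta> x \<le> \<beta> (m \<cdot> x)"
    proof (rule least)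
      fix n assume n: "n \<in> fan"
      have "(n \<cdot> k) \<cdot> (m \<cdot> x) = n \<cdot> ((k \<cdot> m) \<cdot> x)"
        using fan_assoc(1)[OF n] fan_assoc(1)[OF k(1)] by simp
      then show "b (n \<cdot> x) \<le> \<beta> (m \<cdot> x)"
        using upper[OF is_subgroup_mul[OF fan_subgroup n k(1)], of "m \<cdot> x"] k(2) by simp
    qed
  qed
  moreover have "0 < \<beta> \<e>" using upper[OF unit, of \<e>] b(2) by simp
  ultimately show thesis by (rule that)
qed

lemma convolution_kernel:
  assumes f: "f \<in> C00_plus" and g: "g \<in> C00_plus"
  obtains K where "compact K" "\<And>x y. x \<notin> K \<or> y \<notin> K \<Longrightarrow> f (ldiv y x) * g y = 0"
    "continuous_on UNIV (\<lambda>(x, y). f (ldiv y x) * g y)"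
proof -
  obtain L where L: "compact L" "\<And>x. x \<notin> L \<Longrightarrow> f x = 0" using C00_plus_support[OF f] by metis
  obtain M where M: "compact M" "\<And>x. x \<notin> M \<Longrightarrow> g x = 0" using C00_plus_support[OF g] by metis
  define K where "K = M \<union> (\<lambda>(y, u). y \<cdot> u) ` (M \<times> L)"
  show thesis
  proof (rule that)
    show "compact K"
      unfolding K_def by (rule compact_Un[OF M(1) compact_image_pair[OF continuous_mul M(1) L(1)]])
    show "f (ldiv y x) * g y = 0" if xy: "x \<notin> K \<or> y \<notin> K" for x y
    proof (rule ccontr)
      assume "f (ldiv y x) * g y \<noteq> 0"
      then have y: "y \<in> M" and u: "ldiv y x \<in> L" using L(2) M(2) by auto
      have "y \<cdot> ldiv y x \<in> (\<lambda>(y, u). y \<cdot> u) ` (M \<times> L)" using y u by force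
      with xy y show False by (simp add: K_def)
    qed
    have "continuous_on UNIV (\<lambda>z. ldiv (snd z) (fst z))"
      by (rule continuous_on_ldiv) (intro continuous_intros)+
    then have "continuous_on UNIV (\<lambda>z. f (ldiv (snd z) (fst z)))"
      by (rule continuous_on_compose2[OF C00_plus_continuous[OF f] _ subset_UNIV])
    moreover have "continuous_on UNIV (\<lambda>z :: 'a \<times> 'a. g (snd z))"
      by (rule continuous_on_compose2[OF C00_plus_continuous[OF g] _ subset_UNIV])
        (intro continuous_intros)
    ultimately show "continuous_on UNIV (\<lambda>(x, y). f (ldiv y x) * g y)"
      unfolding case_prod_unfold by (rule continuous_on_mult)
  qed
qed

text \<open>Under \<open>H\<close> the left translate \<open>\<lambda>x. f (ldiv y x)\<close> has the same value as \<open>f\<close>, so every left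
  invariant functional evaluates the convolution of \<open>g\<close> and \<open>f\<close> formed with \<open>J\<close> as a product.\<close>
lemma convolution:
  assumes J: "left_invariant_functional mul J" and f: "f \<in> C00_plus" and g: "g \<in> C00_plus"
  shows convolution_in_C00_plus: "(\<lambda>x. J (\<lambda>y. f (ldiv y x) * g y)) \<in> C00_plus"
    and functional_convolution: "\<And>H. left_invariant_functional mul H \<Longrightarrow>
      H (\<lambda>x. J (\<lambda>y. f (ldiv y x) * g y)) = H f * J g"
proof -
  note Jpos = left_invariant_functional_positive[OF J]
  have nonneg: "0 \<le> f (ldiv y x) * g y" for x y
    using C00_plus_nonneg[OF f] C00_plus_nonneg[OF g] by simp
  obtain K where K: "compact K" "\<And>x y. x \<notin> K \<or> y \<notin> K \<Longrightarrow> f (ldiv y x) * g y = 0"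
    "continuous_on UNIV (\<lambda>(x, y). f (ldiv y x) * g y)"
    using convolution_kernel[OF f g] by metis
  show "(\<lambda>x. J (\<lambda>y. f (ldiv y x) * g y)) \<in> C00_plus"
    by (rule functional_of_sections_in_C00_plus[OF Jpos K(1,3) nonneg K(2)])
  fix H assume H: "left_invariant_functional mul H"
  note Hpos = left_invariant_functional_positive[OF H]
  have "H (\<lambda>x. J (\<lambda>y. f (ldiv y x) * g y)) = J (\<lambda>y. H (\<lambda>x. f (ldiv y x) * g y))"
    by (rule positive_functional_Fubini[OF Jpos Hpos K(1,3) nonneg K(2)])
  also have "(\<lambda>y. H (\<lambda>x. f (ldiv y x) * g y)) = (\<lambda>y. H f * g y)"
  proof
    fix y
    have "H (\<lambda>x. g y * f (ldiv y x)) = g y * H f"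
      by (simp add: positive_functional_scale[OF Hpos C00_plus_left_quotient[OF f]
          C00_plus_nonneg[OF g]] left_invariant_functional_left_quotient[OF H f])
    then show "H (\<lambda>x. f (ldiv y x) * g y) = H f * g y" by (simp only: mult.commute)
  qed
  also have "J \<dots> = H f * J g"
    by (rule positive_functional_scale[OF Jpos g positive_functional_nonneg[OF Hpos f]])
  finally show "H (\<lambda>x. J (\<lambda>y. f (ldiv y x) * g y)) = H f * J g" .
qed

text \<open>Convolving from the left with an invariant function averages over the fan: replacing \<open>x\<close> by
  \<open>n x\<close> amounts to translating the integration variable by \<open>n\<close>.\<close>
lemma convolution_fan_invariant:
  assumes J: "left_invariant_functional mul J" and f: "f \<in> C00_plus" and g: "g \<in> C00_plus"
    and inv: "fan_invariant g"
  shows "fan_invariant (\<lambda>x. J (\<lambda>y. f (ldiv y x) * g y))"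
  unfolding fan_invariant_def
proof (intro ballI allI)
  fix n x assume n: "n \<in> fan"
  obtain K where K: "compact K" "\<And>x y. x \<notin> K \<or> y \<notin> K \<Longrightarrow> f (ldiv y x) * g y = 0"
    "continuous_on UNIV (\<lambda>(x, y). f (ldiv y x) * g y)"
    using convolution_kernel[OF f g] by metis
  have nonneg: "0 \<le> f (ldiv y x) * g y" for x y
    using C00_plus_nonneg[OF f] C00_plus_nonneg[OF g] by simp
  have sec: "(\<lambda>y. f (ldiv y (n \<cdot> x)) * g y) \<in> C00_plus"
    by (rule C00_plus_section[OF K(3) nonneg K(1)]) (simp add: K(2))
  have "ldiv (n \<cdot> y) (n \<cdot> x) = ldiv y x" for y
    using fan_assoc(1)[OF n, of y "ldiv y x"] by (intro ldiv_eqI) simp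
  then show "J (\<lambda>y. f (ldiv y (n \<cdot> x)) * g y) = J (\<lambda>y. f (ldiv y x) * g y)"
    using left_invariant_functional_translate[OF J sec, of n] fan_invariantD[OF inv n] by simp
qed

section \<open>Uniqueness on fan-invariant functions\<close>

text \<open>This is Weil's formula. Substituting \<open>y = x z\<close> in the convolution and exchanging the functionals
  a second time exhibits \<open>H f * J g\<close> as the value under \<open>J\<close> of \<open>f\<close>, inverted, against a density that
  depends only on \<open>g\<close> and \<open>H\<close>.\<close>
lemma Weil_formula:
  assumes J: "left_invariant_functional mul J" and H: "left_invariant_functional mul H"
    and f: "f \<in> C00_plus" "fan_invariant f" and g: "g \<in> C00_plus"
  shows Weil_density_in_C00_plus: "(\<lambda>z. f (ldiv z \<e>) * H (\<lambda>x. g (x \<cdot> z))) \<in> C00_plus"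
    and "H f * J g = J (\<lambda>z. f (ldiv z \<e>) * H (\<lambda>x. g (x \<cdot> z)))"
proof -
  note Jpos = left_invariant_functional_positive[OF J]
    and Hpos = left_invariant_functional_positive[OF H]
  have f': "(\<lambda>z. f (ldiv z \<e>)) \<in> C00_plus" by (rule C00_plus_inversion[OF f(1)])
  obtain L where L: "compact L" "\<And>z. z \<notin> L \<Longrightarrow> f (ldiv z \<e>) = 0"
    using C00_plus_support[OF f'] by metis
  obtain M where M: "compact M" "\<And>x. x \<notin> M \<Longrightarrow> g x = 0" using C00_plus_support[OF g] by metis
  define K where "K = L \<union> (\<lambda>(u, z). rdiv u z) ` (M \<times> L)"
  have compact_K: "compact K"
    unfolding K_def
    by (rule compact_Un[OF L(1) compact_image_pair[OF
          continuous_on_swap_arguments[OF continuous_rdiv] M(1) L(1)]])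
  have support: "f (ldiv z \<e>) * g (x \<cdot> z) = 0" if xz: "x \<notin> K \<or> z \<notin> K" for x z
  proof (rule ccontr)
    assume "f (ldiv z \<e>) * g (x \<cdot> z) \<noteq> 0"
    then have z: "z \<in> L" and u: "x \<cdot> z \<in> M" using L(2) M(2) by auto
    have "rdiv (x \<cdot> z) z \<in> (\<lambda>(u, z). rdiv u z) ` (M \<times> L)" using z u by force
    with xz z show False by (simp add: K_def)
  qed
  have nonneg: "0 \<le> f (ldiv z \<e>) * g (x \<cdot> z)" for x z
    using C00_plus_nonneg[OF f(1)] C00_plus_nonneg[OF g] by simp
  have "continuous_on UNIV (\<lambda>z. fst z \<cdot> snd z)"
    by (rule continuous_on_mul) (intro continuous_intros)+
  then have "continuous_on UNIV (\<lambda>z. g (fst z \<cdot> snd z))"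
    by (rule continuous_on_compose2[OF C00_plus_continuous[OF g] _ subset_UNIV])
  moreover have "continuous_on UNIV (\<lambda>z :: 'a \<times> 'a. f (ldiv (snd z) \<e>))"
    by (rule continuous_on_compose2[OF C00_plus_continuous[OF f'] _ subset_UNIV])
      (intro continuous_intros)
  ultimately have cont: "continuous_on UNIV (\<lambda>(x, z). f (ldiv z \<e>) * g (x \<cdot> z))"
    unfolding case_prod_unfold by (intro continuous_on_mult)
  have g': "(\<lambda>x. g (x \<cdot> z)) \<in> C00_plus" for z
  proof (rule C00_plusI)
    have "continuous_on UNIV (\<lambda>x. x \<cdot> z)" by (rule continuous_on_mul) (intro continuous_intros)+
    then show "continuous_on UNIV (\<lambda>x. g (x \<cdot> z))"
      by (rule continuous_on_compose2[OF C00_plus_continuous[OF g] _ subset_UNIV])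
    have "continuous_on M (\<lambda>u. rdiv u z)" by (rule continuous_on_rdiv) (intro continuous_intros)+
    then show "compact ((\<lambda>u. rdiv u z) ` M)" by (rule compact_continuous_image[OF _ M(1)])
    show "g (x \<cdot> z) = 0" if "x \<notin> (\<lambda>u. rdiv u z) ` M" for x
      using that by (intro M(2)) (metis imageI rdiv_cancel)
  qed (rule C00_plus_nonneg[OF g])
  have inner: "(\<lambda>z. H (\<lambda>x. f (ldiv z \<e>) * g (x \<cdot> z))) = (\<lambda>z. f (ldiv z \<e>) * H (\<lambda>x. g (x \<cdot> z)))"
    by (rule ext) (rule positive_functional_scale[OF Hpos g' C00_plus_nonneg[OF f(1)]])
  have "(\<lambda>z. H (\<lambda>x. f (ldiv z \<e>) * g (x \<cdot> z))) \<in> C00_plus"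
    by (rule functional_of_sections_in_C00_plus[OF Hpos compact_K
          continuous_on_swap_arguments[OF cont] nonneg]) (rule support, blast)
  then show "(\<lambda>z. f (ldiv z \<e>) * H (\<lambda>x. g (x \<cdot> z))) \<in> C00_plus" by (simp only: inner)
  have "J (\<lambda>y. f (ldiv y x) * g y) = J (\<lambda>z. f (ldiv z \<e>) * g (x \<cdot> z))" for x
  proof -
    obtain K' where K': "compact K'" "\<And>x y. x \<notin> K' \<or> y \<notin> K' \<Longrightarrow> f (ldiv y x) * g y = 0"
      "continuous_on UNIV (\<lambda>(x, y). f (ldiv y x) * g y)"
      using convolution_kernel[OF f(1) g] by metis
    have "0 \<le> f (ldiv y x) * g y" for x y
      using C00_plus_nonneg[OF f(1)] C00_plus_nonneg[OF g] by simp
    then have sec: "(\<lambda>y. f (ldiv y x) * g y) \<in> C00_plus"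
      by (rule C00_plus_section[OF K'(3) _ K'(1)]) (simp add: K'(2))
    have "J (\<lambda>y. f (ldiv y x) * g y) = J (\<lambda>z. f (ldiv (x \<cdot> z) x) * g (x \<cdot> z))"
      by (rule left_invariant_functional_translate[OF J sec, symmetric])
    then show ?thesis by (simp only: fan_invariant_quotient[OF f(2)])
  qed
  then have "H f * J g = H (\<lambda>x. J (\<lambda>z. f (ldiv z \<e>) * g (x \<cdot> z)))"
    using functional_convolution[OF J f(1) g H] by simp
  also have "\<dots> = J (\<lambda>z. H (\<lambda>x. f (ldiv z \<e>) * g (x \<cdot> z)))"
    by (rule positive_functional_Fubini[OF Jpos Hpos compact_K cont nonneg support])
  finally show "H f * J g = J (\<lambda>z. f (ldiv z \<e>) * H (\<lambda>x. g (x \<cdot> z)))" by (simp only: inner)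
qed

lemma Weil_density_fan_invariant:
  assumes g: "fan_invariant g"
  shows "fan_invariant (\<lambda>z. H (\<lambda>x. g (x \<cdot> z)))"
  unfolding fan_invariant_def
proof (intro ballI allI)
  fix n z assume n: "n \<in> fan"
  have "g (x \<cdot> (n \<cdot> z)) = g (x \<cdot> z)" for x
  proof -
    obtain m where m: "m \<in> fan" "x \<cdot> n = m \<cdot> x"
      using normalizing_right[OF fan_normalizing[OF fan_subgroup fan_nucleus] fan_nucleus n] by metis
    have "x \<cdot> (n \<cdot> z) = m \<cdot> (x \<cdot> z)"
      using fan_assoc(2)[OF n, of x z] fan_assoc(1)[OF m(1), of x z] m(2) by simp
    then show ?thesis using fan_invariantD[OF g m(1)] by simp
  qed
  then show "H (\<lambda>x. g (x \<cdot> (n \<cdot> z))) = H (\<lambda>x. g (x \<cdot> z))" by simp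
qed

text \<open>By Weil's formula the densities of \<open>g\<close> and \<open>h\<close>, rescaled by \<open>J h\<close> and \<open>J g\<close>, have the same
  value under \<open>J\<close> against every invariant function. Testing against the positive part of their
  difference shows that the difference has no positive part, and at \<open>\<e>\<close> the densities are \<open>H g\<close> and
  \<open>H h\<close>. An invariant bump \<open>b\<close> cuts everything down to compact support.\<close>
lemma cross_ratio_le:
  assumes J: "left_invariant_functional mul J" and H: "left_invariant_functional mul H"
    and g: "g \<in> C00_plus" "fan_invariant g" and h: "h \<in> C00_plus" "fan_invariant h"
  shows "H g * J h \<le> H h * J g"
proof -
  note Jpos = left_invariant_functional_positive[OF J]
  have Jg: "0 \<le> J g" and Jh: "0 \<le> J h"
    by (rule positive_functional_nonneg[OF Jpos g(1)], rule positive_functional_nonneg[OF Jpos h(1)])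
  obtain \<beta> where \<beta>: "\<beta> \<in> C00_plus" "fan_invariant \<beta>" "0 < \<beta> \<e>" by (rule ex_fan_invariant_bump)
  define b where "b z = \<beta> (ldiv z \<e>)" for z
  have b: "b \<in> C00_plus" "fan_invariant b" "0 < b \<e>"
    using C00_plus_inversion[OF \<beta>(1)] fan_invariant_inversion[OF \<beta>(2)] \<beta>(3) ldiv_mul[of \<e> \<e>]
    by (simp_all add: b_def[abs_def])
  define G where "G z = H (\<lambda>x. g (x \<cdot> z))" for z
  define D where "D z = H (\<lambda>x. h (x \<cdot> z))" for z
  have inv: "fan_invariant G" "fan_invariant D"
    unfolding G_def[abs_def] D_def[abs_def]
    using Weil_density_fan_invariant[OF g(2), of H] Weil_density_fan_invariant[OF h(2), of H] by simp_all
  define u where "u z = J h * (b z * G z)" for z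
  define v where "v z = J g * (b z * D z)" for z
  have bG: "(\<lambda>z. b z * G z) \<in> C00_plus"
    unfolding G_def b_def by (rule Weil_density_in_C00_plus[OF J H \<beta>(1,2) g(1)])
  have bD: "(\<lambda>z. b z * D z) \<in> C00_plus"
    unfolding D_def b_def by (rule Weil_density_in_C00_plus[OF J H \<beta>(1,2) h(1)])
  have u: "u \<in> C00_plus" unfolding u_def[abs_def] by (rule C00_plus_scale[OF bG Jh])
  have v: "v \<in> C00_plus" unfolding v_def[abs_def] by (rule C00_plus_scale[OF bD Jg])
  define w where "w z = max (u z - v z) 0" for z
  have w: "w \<in> C00_plus" unfolding w_def[abs_def] by (rule C00_plus_positive_part[OF u v])
  note mult = C00_plus_mult[OF w C00_plus_continuous C00_plus_nonneg]
  define \<phi> where "\<phi> z = w z * b z" for z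
  have \<phi>: "\<phi> \<in> C00_plus" unfolding \<phi>_def[abs_def] by (rule mult[OF b(1) b(1)])
  have \<phi>_inv: "fan_invariant \<phi>"
    unfolding fan_invariant_def \<phi>_def w_def u_def v_def
    using fan_invariantD[OF b(2)] fan_invariantD[OF inv(1)] fan_invariantD[OF inv(2)] by simp
  define f where "f z = \<phi> (ldiv z \<e>)" for z
  have f: "f \<in> C00_plus" "fan_invariant f"
    unfolding f_def[abs_def] by (rule C00_plus_inversion[OF \<phi>], rule fan_invariant_inversion[OF \<phi>_inv])
  have f_inv: "f (ldiv z \<e>) = \<phi> z" for z
    unfolding f_def by (rule fan_invariant_inversion_twice[OF \<phi>_inv])
  have scaled: "J (\<lambda>z. w z * (c * (b z * E z))) = c * J (\<lambda>z. \<phi> z * E z)"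
    if "(\<lambda>z. b z * E z) \<in> C00_plus" "0 \<le> c" for c E
  proof -
    have "J (\<lambda>z. c * (w z * (b z * E z))) = c * J (\<lambda>z. w z * (b z * E z))"
      by (rule positive_functional_scale[OF Jpos mult[OF that(1) that(1)] that(2)])
    then show ?thesis by (simp only: \<phi>_def mult.assoc mult.left_commute[of _ c])
  qed
  have "J (\<lambda>z. w z * u z) = J h * (H f * J g)"
    unfolding u_def scaled[OF bG Jh]
    using Weil_formula(2)[OF J H f g(1)] by (simp only: f_inv G_def)
  moreover have "J (\<lambda>z. w z * v z) = J g * (H f * J h)"
    unfolding v_def scaled[OF bD Jg]
    using Weil_formula(2)[OF J H f h(1)] by (simp only: f_inv D_def)
  ultimately have eq: "J (\<lambda>z. w z * u z) = J (\<lambda>z. w z * v z)" by simp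
  have "w z * u z = w z * v z + w z * w z" for z
    by (cases "v z \<le> u z") (simp_all add: w_def algebra_simps)
  then have "J (\<lambda>z. w z * u z) = J (\<lambda>z. w z * v z) + J (\<lambda>z. w z * w z)"
    using positive_functional_add[OF Jpos mult[OF v v] mult[OF w w]] by simp
  then have zero: "J (\<lambda>z. w z * w z) = 0" using eq by simp
  have "\<not> 0 < w \<e>"
  proof
    assume "0 < w \<e>"
    then have "0 < J (\<lambda>z. w z * w z)"
      by (intro left_invariant_functional_strict[OF J mult[OF w w], of \<e>] mult_pos_pos)
    with zero show False by simp
  qed
  then have "u \<e> \<le> v \<e>" by (simp add: w_def)
  then have "b \<e> * (H g * J h) \<le> b \<e> * (H h * J g)"
    by (simp add: u_def v_def G_def D_def mult_ac)
  then show ?thesis using b(3) by simp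
qed

theorem left_invariant_functional_unique:
  assumes J: "left_invariant_functional mul J" and H: "left_invariant_functional mul H"
  shows "\<exists>\<kappa>>0. \<forall>f \<in> C00_plus. H f = \<kappa> * J f"
proof -
  obtain \<beta> where \<beta>: "\<beta> \<in> C00_plus" "fan_invariant \<beta>" "0 < \<beta> \<e>" by (rule ex_fan_invariant_bump)
  have J\<beta>: "0 < J \<beta>" and H\<beta>: "0 < H \<beta>"
    by (rule left_invariant_functional_strict[OF J \<beta>(1,3)],
        rule left_invariant_functional_strict[OF H \<beta>(1,3)])
  have "H f = (H \<beta> / J \<beta>) * J f" if f: "f \<in> C00_plus" for f
  proof -
    define A where "A x = J (\<lambda>y. f (ldiv y x) * \<beta> y)" for x
    have A: "A \<in> C00_plus" "fan_invariant A"
      unfolding A_def[abs_def]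
      by (rule convolution_in_C00_plus[OF J f \<beta>(1)], rule convolution_fan_invariant[OF J f \<beta>(1,2)])
    have "H A = H f * J \<beta>" "J A = J f * J \<beta>"
      unfolding A_def[abs_def]
      by (rule functional_convolution[OF J f \<beta>(1) H], rule functional_convolution[OF J f \<beta>(1) J])
    moreover have "H A * J \<beta> = H \<beta> * J A"
      by (rule antisym[OF cross_ratio_le[OF J H A \<beta>(1,2)] cross_ratio_le[OF J H \<beta>(1,2) A]])
    ultimately show ?thesis using J\<beta> by (simp add: field_simps)
  qed
  then show ?thesis using J\<beta> H\<beta> by (intro exI[of _ "H \<beta> / J \<beta>"]) simp
qed

end

theorem theorem3p20:
  fixes mul :: "'a::t1_space \<Rightarrow> 'a \<Rightarrow> 'a"
    and N0 :: "'a set"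
    and J H :: "('a \<Rightarrow> real) \<Rightarrow> real"
  assumes "topological_fan_loop mul"
    and "locally_compact_space (euclidean :: 'a topology)"
    and "N0 = topological_fan_loop.fan mul"
    and "loop.is_subgroup mul N0"
    and "compact N0"
    and "N0 \<subseteq> loop.nucleus mul"
    and "\<And>a b c. loop.t mul a b c \<in> N0"
    and "\<And>a b c. loop.p mul a b c \<in> N0"
    and "left_invariant_functional mul J"
    and "left_invariant_functional mul H"
  shows "\<exists>\<kappa>>0. \<forall>f \<in> C00_plus. H f = \<kappa> * J f"
proof -
  interpret topological_fan_loop mul by fact
  interpret compact_fan_loop mul
    using assms(2-6) by unfold_locales simp_all
  show ?thesis using assms(9,10) by (rule left_invariant_functional_unique)
qed

end
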